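(* Let $n\ge1$ and let $\mathcal{T}\in\mathcal{BT}_n^B$ be a bare tableau of type $B$ of length $n$. Then $$\mathrm{cyc}(\zeta_{bare}(\mathcal{T}))=\mathrm{dess}(\mathcal{T})+\mathrm{zerorow}(\mathcal{T}).$$
   Context: Signed permutations. $[n]=\{1,\dots,n\}$, $[\pm n]=\{\pm1,\dots,\pm n\}$. $\mathfrak{S}_n^B$ is the group of permutations $\sigma$ of $[\pm n]$ with $\sigma(-i)=-\sigma(i)$. Full cycle notation: $\sigma=(a_{1,1},\dots,a_{1,k_1})\cdots(a_{m,1},\dots,a_{m,k_m})$, where the sets $\{|a_{i,1}|,\dots,|a_{i,k_i}|\}$ are disjoint with union $[n]$, $\sum_i k_i=n$, and $\sigma(|a_{i,j}|)=a_{i,j+1}$ (with $a_{i,k_i+1}=a_{i,1}$). $\mathrm{cyc}(\sigma)=m$ is the number of cycles in the full cycle notation (including the length-one cycles $(a)$, $a>0$ or $a<0$). Diagrams. For $0\le k\le n$, a $(k,n)$-diagram is a left-justified diagram of boxes in a $k\times(n-k)$ rectangle with $\lambda_r$ boxes in row $r$, $\lambda_1\ge\dots\ge\lambda_k\ge0$. A shifted $(k,n)$-diagram is a $(k,n)$-diagram together with a staircase of boxes added above it, the $j$-th column from the left receiving $n-k-j+1$ additional boxes; the topmost box of each column is called a diagonal. Labels: follow the southeast border of the $(k,n)$-diagram from the northeast corner to the southwest corner of the rectangle, labeling its unit steps $1,\dots,n$; a vertical step gives its label to its row, a horizontal step gives its label to its column. Each added (staircase) row, whose diagonal (rightmost)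 box lies in the column labeled $i$, is labeled $-i$. Bare tableau of type $B$ of length $n$ (set $\mathcal{BT}_n^B$): a $(0,1)$-filling of a shifted $(k,n)$-diagram such that (i) every column contains a $1$; (ii) a box with a $1$ above it in its column and a $1$ to its left in its row contains a $0$; (iii) if a diagonal contains $0$, its row contains no $1$. Zigzag paths and $\zeta_{bare}$. The zigzag path from a row (column) starts at the left of that row (the top of that column) moving east (south), switches direction between east and south at each $1$ it meets, and stops when it reaches the right end of a row or the bottom of a column. $\zeta_{bare}:\mathcal{BT}_n^B\to\mathfrak{S}_n^B$ is the map such that for $i\in[n]$: if $i$ labels a row, $\zeta_{bare}(\mathcal{T})(i)$ is the label of the row or column where the path from row $i$ ends; if $-i$ labels a row with $0$ in its diagonal, $\zeta_{bare}(\mathcal{T})(i)$ is the label where the path from column $i$ ends; if $-i$ labels a row with $1$ in its diagonal, $\zeta_{bare}(\mathcal{T})(-i)$ is the label where the path from row $-i$ ends. Statistics. $\mathrm{dess}(\mathcal{T})$ is the number of doubly essential ones, i.e. $1$'s that are both the topmost $1$ in their column and the leftmost $1$ in their row. $\mathrm{zerorow}(\mathcal{T})$ is the number of rows with positive label filled entirely with $0$'s (including rows with no boxes). *)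

theory Defs
  imports "HOL-Library.FuncSet" "HOL-Combinatorics.Permutations"
begin

section \<open>Signed permutations\<close>

definition signed_range :: "nat \<Rightarrow> int set" where
  "signed_range n = {1..int n} \<union> uminus ` {1..int n}"

definition signed_perms :: "nat \<Rightarrow> (int \<Rightarrow> int) set" where
  "signed_perms n = {\<sigma>. \<sigma> permutes signed_range n \<and> (\<forall>i \<in> signed_range n. \<sigma> (- i) = - \<sigma> i)}"

text \<open>
  \<open>cs = [[a\<^sub>1\<^sub>1, \<dots>], \<dots>]\<close> is a way of writing \<open>\<sigma>\<close> in full cycle notation. The distinctness
  condition says that the sets of absolute values of the cycles are disjoint and that no absolute
  value repeats inside a cycle (that is, the lengths of the cycles add up to \<open>n\<close>).
\<close>

definition full_cycle_notation :: "nat \<Rightarrow> (int \<Rightarrow> int) \<Rightarrow> int list list \<Rightarrow> bool" where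
  "full_cycle_notation n \<sigma> cs \<longleftrightarrow>
     \<sigma> \<in> signed_perms n \<and>
     (\<forall>c \<in> set cs. c \<noteq> []) \<and>
     distinct (map abs (concat cs)) \<and>
     abs ` set (concat cs) = {1..int n} \<and>
     (\<forall>c \<in> set cs. \<forall>j < length c. \<sigma> \<bar>c ! j\<bar> = c ! (Suc j mod length c))"

text \<open>
  The full cycle notation is unique up to the order of the cycles and rotation of each cycle, so
  the number of cycles depends on \<open>\<sigma>\<close> only.
\<close>

definition cyc :: "nat \<Rightarrow> (int \<Rightarrow> int) \<Rightarrow> nat" where
  "cyc n \<sigma> = (THE m. \<exists>cs. full_cycle_notation n \<sigma> cs \<and> length cs = m)"


section \<open>Shifted diagrams and their labels\<close>

text \<open>
  A \<open>(k, n)\<close>-diagram is given by the list \<open>lam\<close> of its row lengths from top to bottom, empty rows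
  included, so that \<open>k = length lam\<close>.
\<close>

definition kn_diagram :: "nat \<Rightarrow> nat \<Rightarrow> nat list \<Rightarrow> bool" where
  "kn_diagram k n lam \<longleftrightarrow>
     k \<le> n \<and> length lam = k \<and> sorted_wrt (\<ge>) lam \<and> (\<forall>x \<in> set lam. x \<le> n - k)"

abbreviation ncols :: "nat \<Rightarrow> nat list \<Rightarrow> nat" where
  "ncols n lam \<equiv> n - length lam"

text \<open>
  Boxes of the shifted diagram are pairs (row position, column position). Positions count from 0;
  rows from top to bottom, columns from left to right. With \<open>m = n - k\<close> columns, the leftmost column
  receives \<open>m\<close> additional boxes, so rows \<open>0, \<dots>, m - 1\<close> are the added ones and rows
  \<open>m, \<dots>, n - 1\<close> are those of the \<open>(k, n)\<close>-diagram. The column at position \<open>j\<close> receives \<open>m - j\<close>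
  additional boxes, which occupy the rows \<open>j, \<dots>, m - 1\<close>; its diagonal is therefore \<open>(j, j)\<close>.
\<close>

definition boxes :: "nat \<Rightarrow> nat list \<Rightarrow> (nat \<times> nat) set" where
  "boxes n lam =
     {(p, j). p < n \<and> j < ncols n lam \<and>
        (if p < ncols n lam then j \<le> p else j < lam ! (p - ncols n lam))}"

text \<open>
  A label is the number of steps of the southeast border (from the northeast to the southwest
  corner) up to and including the step in question. The horizontal step of column \<open>j\<close> is preceded by
  the horizontal steps of the columns to its right and by the vertical steps of all rows that have a
  box in column \<open>j\<close>. The vertical step of a row of length \<open>l\<close> is preceded by the
  vertical steps of the rows above it and by \<open>m - l\<close> horizontal steps.
\<close>

definition col_label :: "nat \<Rightarrow> nat list \<Rightarrow> nat \<Rightarrow> int" where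
  "col_label n lam j = int ((ncols n lam - j) + card {r. r < length lam \<and> j < lam ! r})"

definition row_label :: "nat \<Rightarrow> nat list \<Rightarrow> nat \<Rightarrow> int" where
  "row_label n lam p =
     (if p < ncols n lam then - col_label n lam p
      else int ((ncols n lam - lam ! (p - ncols n lam)) + Suc (p - ncols n lam)))"

definition labels_row :: "nat \<Rightarrow> nat list \<Rightarrow> int \<Rightarrow> bool" where
  "labels_row n lam x \<longleftrightarrow> (\<exists>p < n. row_label n lam p = x)"

definition row_of :: "nat \<Rightarrow> nat list \<Rightarrow> int \<Rightarrow> nat" where
  "row_of n lam x = (THE p. p < n \<and> row_label n lam p = x)"

definition col_of :: "nat \<Rightarrow> nat list \<Rightarrow> int \<Rightarrow> nat" where
  "col_of n lam x = (THE j. j < ncols n lam \<and> col_label n lam j = x)"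


section \<open>Bare tableaux of type B\<close>

record tableau =
  shape :: "nat list"
  fill :: "nat \<times> nat \<Rightarrow> nat"

definition has_one :: "nat \<Rightarrow> tableau \<Rightarrow> nat \<Rightarrow> nat \<Rightarrow> bool" where
  "has_one n T p j \<longleftrightarrow> (p, j) \<in> boxes n (shape T) \<and> fill T (p, j) = 1"

definition bare_tableaux_B :: "nat \<Rightarrow> tableau set" where
  "bare_tableaux_B n = {T.
     (\<exists>k. kn_diagram k n (shape T)) \<and>
     fill T \<in> boxes n (shape T) \<rightarrow>\<^sub>E {0, 1} \<and>
     (\<forall>j < ncols n (shape T). \<exists>p. has_one n T p j) \<and>
     (\<forall>(p, j) \<in> boxes n (shape T).
        (\<exists>p' < p. has_one n T p' j) \<and> (\<exists>j' < j. has_one n T p j') \<longrightarrow> fill T (p, j) = 0) \<and>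
     (\<forall>j < ncols n (shape T). fill T (j, j) = 0 \<longrightarrow> \<not> (\<exists>j'. has_one n T j j'))}"

definition dess :: "nat \<Rightarrow> tableau \<Rightarrow> nat" where
  "dess n T = card {(p, j). has_one n T p j \<and>
     \<not> (\<exists>p' < p. has_one n T p' j) \<and> \<not> (\<exists>j' < j. has_one n T p j')}"

definition zerorow :: "nat \<Rightarrow> tableau \<Rightarrow> nat" where
  "zerorow n T = card {p. p < n \<and> 0 < row_label n (shape T) p \<and>
     (\<forall>j. (p, j) \<in> boxes n (shape T) \<longrightarrow> fill T (p, j) = 0)}"


section \<open>Zigzag paths\<close>

datatype direction = East | South

text \<open>
  \<open>zigzag n T d p j\<close> is the label of the row or column where the path ends that enters position
  \<open>(p, j)\<close> while moving in direction \<open>d\<close>. If there is no box at \<open>(p, j)\<close>, the path has just reached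
  the right end of row \<open>p\<close> (moving east) or the bottom of column \<open>j\<close> (moving south).
\<close>

function zigzag :: "nat \<Rightarrow> tableau \<Rightarrow> direction \<Rightarrow> nat \<Rightarrow> nat \<Rightarrow> int" where
  "zigzag n T East p j =
     (if (p, j) \<notin> boxes n (shape T) then row_label n (shape T) p
      else if fill T (p, j) = 1 then zigzag n T South (Suc p) j
      else zigzag n T East p (Suc j))"
| "zigzag n T South p j =
     (if (p, j) \<notin> boxes n (shape T) then col_label n (shape T) j
      else if fill T (p, j) = 1 then zigzag n T East p (Suc j)
      else zigzag n T South (Suc p) j)"
  by pat_completeness auto
termination
  by (relation "measure (\<lambda>(n, T, d, p, j). 2 * n - (p + j))") (auto simp: boxes_def)

declare zigzag.simps [simp del]

definition path_from_row :: "nat \<Rightarrow> tableau \<Rightarrow> int \<Rightarrow> int" where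
  "path_from_row n T x = zigzag n T East (row_of n (shape T) x) 0"

definition path_from_col :: "nat \<Rightarrow> tableau \<Rightarrow> int \<Rightarrow> int" where
  "path_from_col n T x = (let j = col_of n (shape T) x in zigzag n T South j j)"


section \<open>The zigzag map\<close>

text \<open>
  The value at \<open>i \<in> [n]\<close>. The row labelled \<open>-i\<close> has its diagonal at \<open>(p, p)\<close>, where \<open>p\<close> is the
  position of that row. If the diagonal contains a 1, the path from row \<open>-i\<close> gives the value at
  \<open>-i\<close>, whence the sign in the last case.
\<close>

definition zeta_bare_pos :: "nat \<Rightarrow> tableau \<Rightarrow> int \<Rightarrow> int" where
  "zeta_bare_pos n T i =
     (if labels_row n (shape T) i then path_from_row n T i
      else let p = row_of n (shape T) (- i) in
        if fill T (p, p) = 0 then path_from_col n T i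
        else - path_from_row n T (- i))"

definition zeta_bare :: "nat \<Rightarrow> tableau \<Rightarrow> int \<Rightarrow> int" where
  "zeta_bare n T x =
     (if x \<in> {1..int n} then zeta_bare_pos n T x
      else if - x \<in> {1..int n} then - zeta_bare_pos n T (- x)
      else x)"

end

theory Submission
  imports Defs
begin

text \<open>
  The cycles of a signed permutation \<open>\<sigma>\<close> in full cycle notation are the cycles of the ordinary
  permutation \<open>i \<mapsto> \<bar>\<sigma> i\<bar>\<close> of \<open>[n]\<close>, so signs may be forgotten. For \<open>\<sigma> = \<zeta>\<^sub>b\<^sub>a\<^sub>r\<^sub>e(T)\<close> the tableau
  is then a wiring diagram with \<open>n\<close> wires. A row with positive label is a wire; the added row \<open>-i\<close>
  and the column \<open>i\<close> form one wire, which runs east along the row, turns at the diagonal and runs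
  south along the column. If the diagonal contains 0, its row contains no 1, so it makes no difference
  that the path starts only at the top of the column.

  Two wires meet in each off-diagonal box. They cross at a 0, while a 1 makes the paths on them
  exchange wires. Hence the unsigned permutation is the product of the transpositions \<open>(p j)\<close> over
  the off-diagonal 1's \<open>(p, j)\<close>, in the order in which the boxes are swept row by row, each row from
  left to right.

  In this order every new transposition involves a wire that no earlier one has touched
  (lemma \<open>new_wire\<close>): the leftmost 1 of row \<open>p\<close> is the first to touch wire \<open>p\<close>; any other 1, in
  column \<open>j\<close> say, is the topmost in its column, so the diagonal of column \<open>j\<close> contains 0, row \<open>j\<close>
  is empty and wire \<open>j\<close> is untouched. Such a transposition inserts a fixed point into another cycle
  (lemma \<open>cycle_lists_insert\<close>), so each off-diagonal 1 lowers the number of cycles by exactly one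
  and the permutation has \<open>n\<close> minus the number of off-diagonal 1's cycles.

  Finally, each 1 is topmost in its column or leftmost in its row, and doubly essential if both. So
  the number of 1's is the number of columns plus the number of nonzero rows minus \<open>dess\<close>. An added
  row is nonzero exactly if its diagonal is 1, so discarding the diagonal 1's leaves
  \<open>n - zerorow - dess\<close> of them (lemma \<open>count_ones\<close>).
\<close>

section \<open>Cycle decompositions as lists\<close>

text \<open>
  The equation \<open>map f c = rotate1 c\<close> says that \<open>f\<close> sends each entry of \<open>c\<close> to its cyclic successor.
  Unlike the version with indices modulo the length, it is visibly preserved by rotating \<open>c\<close>.
\<close>

definition cycle_lists :: "'a set \<Rightarrow> ('a \<Rightarrow> 'a) \<Rightarrow> 'a list list \<Rightarrow> bool" where
  "cycle_lists S f cs \<longleftrightarrow>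
     [] \<notin> set cs \<and> distinct (concat cs) \<and> set (concat cs) = S \<and> (\<forall>c \<in> set cs. map f c = rotate1 c)"

lemma map_eq_rotate1_iff:
  "map f c = rotate1 c \<longleftrightarrow> (\<forall>j < length c. f (c ! j) = c ! (Suc j mod length c))"
  by (auto simp: list_eq_iff_nth_eq nth_rotate1)

lemma map_rotate_eq_rotate1:
  assumes "map f c = rotate1 c"
  shows "map f (rotate k c) = rotate1 (rotate k c)"
  using assms by (metis rotate_map rotate1_rotate_swap)

lemma set_cycle_eq_orbit:
  assumes "map f c = rotate1 c" "x \<in> set c"
  shows "set c = range (\<lambda>k. (f ^^ k) x)"
proof -
  obtain xs ys where c: "c = xs @ x # ys" using assms(2) by (meson split_list)
  define d where "d = rotate (length xs) c"
  have d: "d = x # ys @ xs" by (simp add: d_def c rotate_append)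
  have f: "\<And>j. j < length d \<Longrightarrow> f (d ! j) = d ! (Suc j mod length d)"
    using map_rotate_eq_rotate1[OF assms(1)] unfolding d_def map_eq_rotate1_iff by blast
  have pow: "(f ^^ k) x = d ! (k mod length d)" for k
  proof (induction k)
    case 0 show ?case by (simp add: d)
  next
    case (Suc k)
    have "k mod length d < length d" by (simp add: d)
    with f[OF this] Suc show ?case by (simp add: mod_Suc_eq)
  qed
  have "set d \<subseteq> range (\<lambda>k. (f ^^ k) x)"
  proof
    fix y assume "y \<in> set d"
    then obtain j where "j < length d" "y = d ! j" by (metis in_set_conv_nth)
    then have "y = (f ^^ j) x" by (simp add: pow)
    then show "y \<in> range (\<lambda>k. (f ^^ k) x)" by blast
  qed
  moreover have "(f ^^ k) x \<in> set d" for k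
    unfolding pow by (rule nth_mem) (simp add: d)
  moreover have "set d = set c" by (simp add: d_def)
  ultimately show ?thesis by auto
qed

lemma distinct_map_set:
  assumes "[] \<notin> set cs" "distinct (concat cs)"
  shows "distinct (map set cs)"
  using assms
proof (induction cs)
  case (Cons c cs)
  have "set c \<noteq> set d" if "d \<in> set cs" for d
    using Cons.prems that by (cases c) auto
  then show ?case using Cons by auto
qed simp

text \<open>
  The entries of the lists are the orbits, which depend on \<open>f\<close> only. So all decompositions of \<open>f\<close>
  have the same length; this is what makes \<open>cyc\<close> well defined.
\<close>

lemma length_cycle_lists:
  assumes "cycle_lists S f cs"
  shows "length cs = card ((\<lambda>x. range (\<lambda>k. (f ^^ k) x)) ` S)"
proof -
  have ne: "[] \<notin> set cs" and di: "distinct (concat cs)" and S: "S = set (concat cs)"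
    and r: "\<And>c. c \<in> set cs \<Longrightarrow> map f c = rotate1 c"
    using assms by (auto simp: cycle_lists_def)
  have "(\<lambda>x. range (\<lambda>k. (f ^^ k) x)) ` S = set (map set cs)"
  proof (intro equalityI subsetI)
    fix X assume "X \<in> (\<lambda>x. range (\<lambda>k. (f ^^ k) x)) ` S"
    then obtain x c where "c \<in> set cs" "x \<in> set c" "X = range (\<lambda>k. (f ^^ k) x)"
      by (auto simp: S)
    then show "X \<in> set (map set cs)" using set_cycle_eq_orbit[OF r] by auto
  next
    fix X assume "X \<in> set (map set cs)"
    then obtain c where c: "c \<in> set cs" "X = set c" by auto
    with ne obtain x where x: "x \<in> set c" by (metis list.set_intros(1) neq_Nil_conv)
    with c have "X = range (\<lambda>k. (f ^^ k) x)" using set_cycle_eq_orbit[OF r] by auto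
    moreover have "x \<in> S" using c x by (auto simp: S)
    ultimately show "X \<in> (\<lambda>x. range (\<lambda>k. (f ^^ k) x)) ` S" by blast
  qed
  then show ?thesis using distinct_card[OF distinct_map_set[OF ne di]] by simp
qed

text \<open>
  If \<open>a\<close> is a fixed point, then \<open>transpose a b \<circ> f\<close> sends the predecessor of \<open>b\<close> to \<open>a\<close> and \<open>a\<close> to
  \<open>b\<close>. So the cycle \<open>[a]\<close> disappears and \<open>a\<close> is inserted in front of \<open>b\<close> in the cycle of \<open>b\<close>.
\<close>

lemma cycle_lists_insert:
  assumes cyc: "cycle_lists S f cs" and fix_a: "f a = a" and a: "a \<in> S" and b: "b \<in> S" and ab: "a \<noteq> b"
  shows "\<exists>cs'. cycle_lists S (transpose a b \<circ> f) cs' \<and> Suc (length cs') = length cs"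
proof -
  have ne: "[] \<notin> set cs" and di: "distinct (concat cs)" and S: "S = set (concat cs)"
    and r: "\<And>c. c \<in> set cs \<Longrightarrow> map f c = rotate1 c"
    using cyc by (auto simp: cycle_lists_def)
  obtain c where c: "c \<in> set cs" "b \<in> set c" using b by (auto simp: S)
  obtain d where d: "d \<in> set cs" "a \<in> set d" using a by (auto simp: S)
  have dset: "set d = {a}"
  proof -
    have "(f ^^ k) a = a" for k by (induction k) (auto simp: fix_a)
    then show ?thesis using set_cycle_eq_orbit[OF r[OF d(1)] d(2)] by auto
  qed
  have "distinct d" using di d by (auto simp: distinct_concat_iff)
  then have da: "d = [a]" using dset
    by (metis distinct_card card.empty card.insert empty_iff finite.emptyI length_0_conv
        length_Suc_conv list.set_intros(1) singletonD One_nat_def)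
  then have cd: "c \<noteq> d" using c ab by auto
  obtain xs ys where cxy: "c = xs @ b # ys" using c(2) by (meson split_list)
  \<comment> \<open>Rotate the cycle of \<open>b\<close> so that \<open>b\<close> comes first; the merged cycle is then \<open>a # e\<close>.\<close>
  define e where "e = b # ys @ xs"
  have e: "rotate (length xs) c = e" by (simp add: cxy rotate_append e_def)
  have re: "map f e = ys @ xs @ [b]"
    using map_rotate_eq_rotate1[OF r[OF c(1)], of "length xs"] unfolding e by (simp add: e_def)
  obtain us vs where cs: "cs = us @ c # vs" using c(1) by (meson split_list)
  have duv: "d \<in> set (us @ vs)" using d cd by (auto simp: cs)
  define ds where "ds = remove1 d (us @ vs)"
  obtain ps qs where pq: "us @ vs = ps @ d # qs" "ds = ps @ qs"
    using duv unfolding ds_def by (metis split_list_first remove1_append remove1.simps(2))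
  have dist: "distinct (c @ [a] @ concat ds)"
    and Seq: "S = set (c @ [a] @ concat ds)"
    and sub: "set ds \<subseteq> set cs"
    and len: "length cs = Suc (Suc (length ds))"
  proof -
    have pqc: "concat us @ concat vs = concat ps @ a # concat qs"
      using arg_cong[OF pq(1), of concat] by (simp add: da)
    have d1: "distinct (c @ concat us @ concat vs)" using di by (auto simp: cs)
    have d2: "distinct (c @ concat ps @ a # concat qs)" using d1 unfolding pqc .
    show "distinct (c @ [a] @ concat ds)" using d2 by (auto simp: pq(2))
    have "S = set (c @ concat us @ concat vs)" by (auto simp: S cs)
    then have "S = set (c @ concat ps @ a # concat qs)" unfolding pqc .
    then show "S = set (c @ [a] @ concat ds)" by (auto simp: pq(2))
    have "set ds \<subseteq> set (us @ vs)" by (auto simp: pq)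
    then show "set ds \<subseteq> set cs" by (auto simp: cs)
    have "length (us @ vs) = Suc (length ds)" by (simp only: pq) simp
    then show "length cs = Suc (Suc (length ds))" by (simp add: cs)
  qed
  have away: "map (transpose a b) zs = zs" if "a \<notin> set zs" "b \<notin> set zs" for zs
    using that by (induction zs) (auto simp: transpose_def)
  have "map (transpose a b \<circ> f) (a # e) = rotate1 (a # e)"
  proof -
    have "map (transpose a b \<circ> f) e = map (transpose a b) (map f e)" by simp
    also have "\<dots> = ys @ xs @ [a]"
      unfolding re using away[of ys] away[of xs] dist by (auto simp: cxy)
    finally show ?thesis by (simp add: fix_a e_def)
  qed
  moreover have "map (transpose a b \<circ> f) z = rotate1 z" if z: "z \<in> set ds" for z
  proof -
    have "map (transpose a b \<circ> f) z = map (transpose a b) (map f z)" by simp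
    also have "map f z = rotate1 z" using r z sub by auto
    also have "map (transpose a b) (rotate1 z) = rotate1 z"
      using dist z c(2) by (intro away) auto
    finally show ?thesis .
  qed
  ultimately have "cycle_lists S (transpose a b \<circ> f) ((a # e) # ds)"
    using dist Seq ne sub by (auto simp: cycle_lists_def e_def cxy)
  then show ?thesis using len by (intro exI[of _ "(a # e) # ds"]) simp
qed

section \<open>Products of transpositions along a growing forest\<close>

text \<open>
  Here \<open>f\<close> is the product of the transpositions given by the edges in \<open>E\<close>, where each edge has an end
  that was isolated before it was added. The order of the factors is hidden in the derivation, so
  that only the edge set has to be tracked.
\<close>

inductive grown :: "'a set \<Rightarrow> ('a \<times> 'a) set \<Rightarrow> ('a \<Rightarrow> 'a) \<Rightarrow> bool" for S where
  empty: "grown S {} id"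
| attach: "\<lbrakk>grown S E f; a \<in> S; b \<in> S; a \<noteq> b; a \<notin> Field E \<or> b \<notin> Field E\<rbrakk>
    \<Longrightarrow> grown S (insert (a, b) E) (transpose a b \<circ> f)"

lemma grown_permutes: "grown S E f \<Longrightarrow> f permutes S"
proof (induction rule: grown.induct)
  case empty
  show ?case by (rule permutes_id)
next
  case (attach E f a b)
  then show ?case by (intro permutes_compose permutes_swap_id)
qed

lemma grown_fixes: "grown S E f \<Longrightarrow> x \<notin> Field E \<Longrightarrow> f x = x"
  by (induction rule: grown.induct) (auto simp: Field_insert transpose_def)

lemma grown_finite: "grown S E f \<Longrightarrow> finite E"
  by (induction rule: grown.induct) auto

lemma grown_cycle_lists:
  assumes "grown S E f" "finite S"
  shows "\<exists>cs. cycle_lists S f cs \<and> length cs + card E = card S"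
  using assms
proof (induction rule: grown.induct)
  case empty
  obtain xs where xs: "set xs = S" "distinct xs"
    using finite_distinct_list[OF empty] by blast
  have "cycle_lists S id (map (\<lambda>x. [x]) xs)"
    using xs by (auto simp: cycle_lists_def concat_map_singleton)
  moreover have "length xs = card S" using xs distinct_card by metis
  ultimately show ?case by (metis card.empty length_map add_0_right)
next
  case (attach E f a b)
  then obtain cs where cs: "cycle_lists S f cs" "length cs + card E = card S" by auto
  have "\<exists>cs'. cycle_lists S (transpose a b \<circ> f) cs' \<and> Suc (length cs') = length cs"
  proof (cases "a \<in> Field E")
    case True
    then have "f b = b" using attach grown_fixes by metis
    from cycle_lists_insert[OF cs(1) this \<open>b \<in> S\<close> \<open>a \<in> S\<close>] attach show ?thesis
      by (simp add: transpose_commute)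
  next
    case False
    then have "f a = a" using attach grown_fixes by metis
    from cycle_lists_insert[OF cs(1) this \<open>a \<in> S\<close> \<open>b \<in> S\<close>] attach show ?thesis by simp
  qed
  moreover have "(a, b) \<notin> E" using attach by (auto simp: Field_def)
  ultimately show ?case using cs(2) grown_finite[OF attach.hyps(1)]
    by (metis add_Suc_right add_Suc card_insert_disjoint)
qed

section \<open>The number of cycles of a signed permutation\<close>

lemma full_cycle_notation_cycle_lists:
  assumes "full_cycle_notation n \<sigma> cs"
  shows "cycle_lists {1..int n} (\<lambda>x. \<bar>\<sigma> x\<bar>) (map (map abs) cs)"
proof -
  have "map (\<lambda>x. \<bar>\<sigma> x\<bar>) (map abs c) = rotate1 (map abs c)" if "c \<in> set cs" for c
    unfolding map_eq_rotate1_iff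
  proof (intro allI impI)
    fix j assume j: "j < length (map abs c)"
    then have "Suc j mod length c < length c" by (intro mod_less_divisor) auto
    then show "\<bar>\<sigma> (map abs c ! j)\<bar> = map abs c ! (Suc j mod length (map abs c))"
      using assms that j by (auto simp: full_cycle_notation_def)
  qed
  moreover have "concat (map (map abs) cs) = map abs (concat cs)" by (simp add: map_concat)
  ultimately show ?thesis using assms
    unfolding cycle_lists_def full_cycle_notation_def by (auto simp del: set_concat)
qed

lemma cyc_eq_length:
  assumes "full_cycle_notation n \<sigma> cs"
  shows "cyc n \<sigma> = length cs"
  unfolding cyc_def
proof (rule the_equality)
  show "\<exists>cs'. full_cycle_notation n \<sigma> cs' \<and> length cs' = length cs" using assms by blast
  show "m = length cs" if "\<exists>ds. full_cycle_notation n \<sigma> ds \<and> length ds = m" for m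
    using that assms length_cycle_lists[OF full_cycle_notation_cycle_lists]
    by (metis length_map)
qed

text \<open>
  A signed permutation is recovered from a permutation \<open>\<pi>\<close> of labelled objects together with signs.
  To write it in full cycle notation, replace each entry \<open>w\<close> in the cycles of \<open>\<pi>\<close> by the value of
  \<open>f\<close> at the label of the predecessor of \<open>w\<close>, which is the label of \<open>w\<close> with the right sign.
\<close>

lemma cyc_relabelled:
  fixes lab :: "'a \<Rightarrow> int"
  assumes lab: "bij_betw lab S {1..int n}"
    and \<pi>: "\<pi> permutes S" and cs: "cycle_lists S \<pi> cs"
    and abs_f: "\<And>w. w \<in> S \<Longrightarrow> \<bar>f (lab w)\<bar> = lab (\<pi> w)"
    and odd_f: "\<And>x. x \<in> signed_range n \<Longrightarrow> f (- x) = - f x"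
    and out_f: "\<And>x. x \<notin> signed_range n \<Longrightarrow> f x = x"
  shows "cyc n f = length cs"
proof -
  have labS: "lab w \<in> {1..int n}" if "w \<in> S" for w using lab that by (meson bij_betwE)
  have lab_inv: "\<exists>w \<in> S. x = lab w" if "x \<in> {1..int n}" for x
    using lab that unfolding bij_betw_def by blast
  have range_iff: "x \<in> signed_range n \<longleftrightarrow> \<bar>x\<bar> \<in> {1..int n}" for x
    by (auto simp: signed_range_def image_iff abs_if)
  have \<pi>S: "\<pi> w \<in> S" if "w \<in> S" for w using \<pi> that by (simp add: permutes_in_image)
  have abs_odd: "\<bar>f x\<bar> = \<bar>f \<bar>x\<bar>\<bar>" if "x \<in> signed_range n" for x
    using odd_f[OF that] by (auto simp: abs_if)
  have f_range: "f x \<in> signed_range n" if x: "x \<in> signed_range n" for x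
  proof -
    obtain w where w: "w \<in> S" "\<bar>x\<bar> = lab w" using lab_inv x range_iff by metis
    have "\<bar>f x\<bar> = lab (\<pi> w)" using abs_odd[OF x] abs_f[OF w(1)] by (simp add: w(2))
    then show ?thesis using labS[OF \<pi>S[OF w(1)]] by (simp add: range_iff)
  qed
  have inj: "inj_on f (signed_range n)"
  proof (rule inj_onI)
    fix x y assume x: "x \<in> signed_range n" and y: "y \<in> signed_range n" and eq: "f x = f y"
    obtain v where v: "v \<in> S" "\<bar>x\<bar> = lab v" using lab_inv x range_iff by metis
    obtain w where w: "w \<in> S" "\<bar>y\<bar> = lab w" using lab_inv y range_iff by metis
    have "lab (\<pi> v) = lab (\<pi> w)"
      using abs_odd[OF x] abs_odd[OF y] abs_f[OF v(1)] abs_f[OF w(1)] eq by (simp add: v w)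
    then have "\<pi> v = \<pi> w" using lab \<pi>S v w by (meson bij_betw_def inj_onD)
    then have "v = w" using \<pi> by (metis permutes_def)
    then have "\<bar>x\<bar> = \<bar>y\<bar>" using v w by simp
    moreover have "f y \<noteq> 0" using f_range[OF y] by (auto simp: range_iff)
    ultimately show "x = y" using odd_f[OF y] eq by (auto simp: abs_eq_iff)
  qed
  have fin: "finite (signed_range n)" by (simp add: signed_range_def)
  have "f ` signed_range n = signed_range n"
    using f_range by (intro endo_inj_surj[OF fin _ inj]) auto
  then have "f permutes signed_range n"
    using inj out_f by (intro bij_imp_permutes) (auto simp: bij_betw_def)
  then have sp: "f \<in> signed_perms n" using odd_f by (auto simp: signed_perms_def)
  define s where "s w = f (lab (inv \<pi> w))" for w
  have abs_s: "\<bar>s w\<bar> = lab w" if "w \<in> S" for w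
    using abs_f[of "inv \<pi> w"] that \<pi>
    by (simp add: s_def permutes_inv permutes_in_image permutes_inverses)
  have c: "[] \<notin> set cs" "distinct (concat cs)" "set (concat cs) = S"
      "\<And>c. c \<in> set cs \<Longrightarrow> map \<pi> c = rotate1 c"
    using cs by (auto simp: cycle_lists_def)
  have conc: "map abs (concat (map (map s) cs)) = map lab (concat cs)"
    using abs_s c(3) by (simp only: map_concat[symmetric] map_map) (auto simp del: set_concat)
  have "full_cycle_notation n f (map (map s) cs)"
    unfolding full_cycle_notation_def
  proof (intro conjI ballI allI impI)
    show "c' \<noteq> []" if "c' \<in> set (map (map s) cs)" for c' using that c(1) by auto
    show "distinct (map abs (concat (map (map s) cs)))"
      unfolding conc using c lab by (auto simp: distinct_map bij_betw_def simp del: set_concat)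
    have "abs ` set (concat (map (map s) cs)) = lab ` set (concat cs)"
      using arg_cong[OF conc, of set] by (simp del: set_concat)
    then show "abs ` set (concat (map (map s) cs)) = {1..int n}"
      using c(3) lab by (simp add: bij_betw_def del: set_concat)
    fix c' j assume c': "c' \<in> set (map (map s) cs)" and j: "j < length c'"
    then obtain d where d: "d \<in> set cs" "c' = map s d" by auto
    have jd: "j < length d" "Suc j mod length d < length d"
      using j d by (auto intro!: mod_less_divisor)
    have dS: "d ! j \<in> S" using d jd c(3) by auto
    have "f \<bar>c' ! j\<bar> = f (lab (d ! j))" using abs_s[OF dS] d jd by simp
    also have "\<dots> = s (\<pi> (d ! j))" using \<pi> by (simp add: s_def permutes_inverses)
    also have "\<pi> (d ! j) = d ! (Suc j mod length d)"
      using c(4)[OF d(1)] jd unfolding map_eq_rotate1_iff by blast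
    finally show "f \<bar>c' ! j\<bar> = c' ! (Suc j mod length c')" using d jd by simp
  qed (rule sp)
  then show ?thesis using cyc_eq_length by fastforce
qed

section \<open>Labels of the wires\<close>

locale bare_tableau =
  fixes n :: nat and T :: tableau
  assumes bare: "T \<in> bare_tableaux_B n"
begin

abbreviation lam :: "nat list" where "lam \<equiv> shape T"
abbreviation m :: nat where "m \<equiv> n - length lam"
abbreviation one :: "nat \<Rightarrow> nat \<Rightarrow> bool" where "one \<equiv> has_one n T"

lemma length_lam: "length lam \<le> n"
  and lam_le: "r < length lam \<Longrightarrow> lam ! r \<le> m"
  and lam_mono: "r \<le> r' \<Longrightarrow> r' < length lam \<Longrightarrow> lam ! r' \<le> lam ! r"
  using bare unfolding bare_tableaux_B_def kn_diagram_def
  by (auto simp: sorted_wrt_iff_nth_less) (metis le_neq_implies_less order_refl)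

lemma fill_range: "(p, j) \<in> boxes n lam \<Longrightarrow> fill T (p, j) \<in> {0, 1}"
  using bare unfolding bare_tableaux_B_def by (auto simp: PiE_def Pi_def)

lemma column_has_one: "j < m \<Longrightarrow> \<exists>p. one p j"
  using bare unfolding bare_tableaux_B_def by blast

lemma topmost_or_leftmost:
  assumes "one p j" "j' < j" "one p j'"
  shows "\<not> (p' < p \<and> one p' j)"
  using bare assms unfolding bare_tableaux_B_def has_one_def by fastforce

lemma diagonal_box: "j < m \<Longrightarrow> (j, j) \<in> boxes n lam"
  by (auto simp: boxes_def)

lemma one_diagonal:
  assumes "one p j" "p < m"
  shows "one p p"
proof -
  have "fill T (p, p) \<noteq> 0" using bare assms unfolding bare_tableaux_B_def by blast
  then show ?thesis using fill_range[OF diagonal_box[OF assms(2)]] diagonal_box[OF assms(2)]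
    by (auto simp: has_one_def)
qed

lemma one_bounds:
  assumes "one p j"
  shows "p < n" "j < m" "j \<le> p"
  using assms lam_le by (auto simp: has_one_def boxes_def split: if_splits)

text \<open>
  Wires are numbered by row positions: wire \<open>w < m\<close> consists of the added row \<open>w\<close> and the column \<open>w\<close>,
  which meet at the diagonal \<open>(w, w)\<close>; the others are the rows of the \<open>(k, n)\<close>-diagram.
\<close>

definition lab :: "nat \<Rightarrow> int" where
  "lab w = (if w < m then col_label n lam w else row_label n lam w)"

lemma card_long_rows_le: "card {r. r < length lam \<and> j < lam ! r} \<le> length lam"
  using card_mono[of "{..<length lam}" "{r. r < length lam \<and> j < lam ! r}"] by auto

lemma lab_range: "w < n \<Longrightarrow> lab w \<in> {1..int n}"
  using card_long_rows_le[of w] length_lam lam_le[of "w - m"]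
  by (auto simp: lab_def col_label_def row_label_def of_nat_diff)

lemma col_label_decreasing:
  assumes "i < j" "j < m"
  shows "col_label n lam j < col_label n lam i"
proof -
  have "card {r. r < length lam \<and> j < lam ! r} \<le> card {r. r < length lam \<and> i < lam ! r}"
    using assms by (intro card_mono) auto
  then show ?thesis using assms by (simp add: col_label_def)
qed

lemma row_label_increasing:
  assumes "m \<le> p" "p < q" "q < n"
  shows "row_label n lam p < row_label n lam q"
proof -
  have "lam ! (q - m) \<le> lam ! (p - m)" using assms by (intro lam_mono) linarith+
  then have "m - lam ! (p - m) \<le> m - lam ! (q - m)" by (rule diff_le_mono2)
  then show ?thesis using assms by (simp add: row_label_def)
qed

text \<open>
  The vertical step of a row precedes the horizontal step of a column on the border exactly if the
  row has a box in that column; the two cases of the proof are the two orders.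
\<close>

lemma col_label_neq_row_label:
  assumes "j < m" "m \<le> p" "p < n"
  shows "col_label n lam j \<noteq> row_label n lam p"
proof (cases "j < lam ! (p - m)")
  case True
  have "{..p - m} \<subseteq> {r. r < length lam \<and> j < lam ! r}"
    using assms True lam_mono[of _ "p - m"] by fastforce
  then have "card {..p - m} \<le> card {r. r < length lam \<and> j < lam ! r}"
    by (intro card_mono) auto
  then show ?thesis using assms True lam_le[of "p - m"] by (simp add: col_label_def row_label_def)
next
  case False
  have "{r. r < length lam \<and> j < lam ! r} \<subseteq> {..<p - m}"
  proof
    fix r assume r: "r \<in> {r. r < length lam \<and> j < lam ! r}"
    show "r \<in> {..<p - m}"
    proof (rule ccontr)
      assume "r \<notin> {..<p - m}"
      then have "lam ! r \<le> lam ! (p - m)" using r by (intro lam_mono) auto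
      then show False using r False by auto
    qed
  qed
  then have "card {r. r < length lam \<and> j < lam ! r} \<le> card {..<p - m}"
    by (intro card_mono) auto
  then show ?thesis using assms False by (simp add: col_label_def row_label_def)
qed

lemma lab_inj: "inj_on lab {..<n}"
proof (rule linorder_inj_onI')
  fix v w assume "v \<in> {..<n}" "w \<in> {..<n}" "v < w"
  then show "lab v \<noteq> lab w"
    using col_label_decreasing[of v w] row_label_increasing[of v w] col_label_neq_row_label[of v w]
    by (auto simp: lab_def)
qed

lemma lab_bij: "bij_betw lab {..<n} {1..int n}"
proof -
  have "lab ` {..<n} = {1..int n}"
    using lab_range by (intro card_subset_eq) (auto simp: card_image[OF lab_inj])
  then show ?thesis using lab_inj by (simp add: bij_betw_def)
qed

lemma row_label_pos_iff:
  assumes "p < n"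
  shows "0 < row_label n lam p \<longleftrightarrow> m \<le> p"
  using lab_range[OF assms] by (auto simp: lab_def row_label_def split: if_splits)

lemma row_label_inj: "inj_on (row_label n lam) {..<n}"
proof (rule linorder_inj_onI')
  fix v w assume *: "v \<in> {..<n}" "w \<in> {..<n}" "v < w"
  show "row_label n lam v \<noteq> row_label n lam w"
  proof (cases "w < m")
    case True
    then show ?thesis using * col_label_decreasing[of v w] by (auto simp: row_label_def)
  next
    case False
    then show ?thesis
      using * row_label_increasing[of v w] row_label_pos_iff[of v] row_label_pos_iff[of w]
      by (cases "m \<le> v") auto
  qed
qed

lemma row_of_row_label: "p < n \<Longrightarrow> row_of n lam (row_label n lam p) = p"
  unfolding row_of_def using row_label_inj by (auto intro!: the_equality dest: inj_onD)

lemma col_of_col_label: "j < m \<Longrightarrow> col_of n lam (col_label n lam j) = j"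
  unfolding col_of_def
  by (rule the_equality) (auto, metis col_label_decreasing less_irrefl nat_neq_iff)

lemma labels_row_lab:
  assumes "w < n"
  shows "labels_row n lam (lab w) \<longleftrightarrow> m \<le> w"
proof
  assume "labels_row n lam (lab w)"
  then obtain p where p: "p < n" "row_label n lam p = lab w" by (auto simp: labels_row_def)
  then have "m \<le> p" using row_label_pos_iff[OF p(1)] lab_range[OF assms] by auto
  then have "lab p = lab w" using p by (simp add: lab_def)
  then show "m \<le> w" using lab_inj assms p \<open>m \<le> p\<close> by (auto dest: inj_onD)
next
  assume "m \<le> w"
  then show "labels_row n lam (lab w)" using assms by (auto simp: labels_row_def lab_def)
qed

section \<open>Sweeping the boxes row by row\<close>

text \<open>
  The end of the path that \<open>\<zeta>\<^sub>b\<^sub>a\<^sub>r\<^sub>e\<close> assigns to the label of wire \<open>w\<close>, up to sign. With a 0 in the diagonal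
  the path skips the row part of the wire, which contains no 1.
\<close>

definition wire_end :: "nat \<Rightarrow> int" where
  "wire_end w = (if w < m \<and> fill T (w, w) = 0 then zigzag n T South w w else zigzag n T East w 0)"

lemma abs_zeta_bare_lab:
  assumes "w < n"
  shows "\<bar>zeta_bare n T (lab w)\<bar> = \<bar>wire_end w\<bar>"
proof (cases "w < m")
  case True
  then have "row_of n lam (- lab w) = w"
    using row_of_row_label[OF assms] by (simp add: lab_def row_label_def)
  moreover have "col_of n lam (lab w) = w" using True by (simp add: lab_def col_of_col_label)
  ultimately show ?thesis
    using True labels_row_lab[OF assms] lab_range[OF assms]
    by (simp add: zeta_bare_def zeta_bare_pos_def wire_end_def path_from_row_def path_from_col_def)
next
  case False
  then show ?thesis
    using labels_row_lab[OF assms] lab_range[OF assms] row_of_row_label[OF assms]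
    by (simp add: zeta_bare_def zeta_bare_pos_def wire_end_def path_from_row_def lab_def)
qed

text \<open>
  The end of the path that is on wire \<open>w\<close> when the boxes before \<open>(p, j)\<close> have been swept. The columns
  left of \<open>j\<close> have already passed row \<open>p\<close>, the other columns are about to enter it, a row of the
  \<open>(k, n)\<close>-diagram above \<open>p\<close> has been left at its right end, wire \<open>p\<close> is about to enter \<open>(p, j)\<close>
  unless it skips its row, and the later wires have not started.
\<close>

definition end_from :: "nat \<Rightarrow> nat \<Rightarrow> nat \<Rightarrow> int" where
  "end_from p j w =
     (if w < j then zigzag n T South (Suc p) w
      else if w < p then if w < m then zigzag n T South p w else lab w
      else if w = p \<and> \<not> (p < m \<and> fill T (p, p) = 0) then zigzag n T East p j
      else wire_end w)"

lemma end_from_0: "end_from 0 0 w = wire_end w"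
  by (auto simp: end_from_def wire_end_def)

lemma end_from_n: "w < n \<Longrightarrow> end_from n 0 w = lab w"
  by (auto simp: end_from_def lab_def zigzag.simps(2) boxes_def)

lemma no_box_below:
  assumes "(p, j) \<notin> boxes n lam" "j < p"
  shows "(Suc p, j) \<notin> boxes n lam"
proof
  assume below: "(Suc p, j) \<in> boxes n lam"
  then have bounds: "Suc p < n" "j < m" by (auto simp: boxes_def)
  have "m \<le> p" "lam ! (p - m) \<le> j"
    using assms bounds by (auto simp: boxes_def split: if_splits)
  moreover from this have "lam ! (Suc p - m) \<le> lam ! (p - m)"
    using bounds by (intro lam_mono) linarith+
  ultimately show False using below by (auto simp: boxes_def)
qed

lemma no_box_right: "(p, j) \<notin> boxes n lam \<Longrightarrow> (p, Suc j) \<notin> boxes n lam"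
  by (auto simp: boxes_def split: if_splits)

text \<open>
  At a 1 the path coming along row \<open>p\<close> turns into column \<open>j\<close> and vice versa. Both paths do arrive:
  a row with a 1 has no 0 in its diagonal, so wire \<open>p\<close> has not skipped its row.
\<close>

lemma end_from_one:
  assumes "one p j" "j < p"
  shows "end_from p (Suc j) (transpose p j w) = end_from p j w"
proof -
  have box: "(p, j) \<in> boxes n lam" "fill T (p, j) = 1" using assms by (auto simp: has_one_def)
  have dg: "\<not> (p < m \<and> fill T (p, p) = 0)"
    using one_diagonal[OF assms(1)] by (auto simp: has_one_def)
  consider "w = p" | "w = j" | "w \<noteq> p" "w \<noteq> j" by blast
  then show ?thesis
  proof cases
    case 1
    have "zigzag n T East p j = zigzag n T South (Suc p) j" using box by (subst zigzag.simps(1)) simp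
    then show ?thesis using 1 dg assms by (simp add: end_from_def)
  next
    case 2
    have "zigzag n T South p j = zigzag n T East p (Suc j)" using box by (subst zigzag.simps(2)) simp
    then show ?thesis using 2 dg assms one_bounds[OF assms(1)] by (simp add: end_from_def)
  next
    case 3
    then show ?thesis by (simp add: end_from_def transpose_def less_Suc_eq)
  qed
qed

text \<open>
  Nothing happens at a 0. The same holds at a position without a box, since a path that has left the
  diagram never meets it again and its end is the label of the wire it is on.
\<close>

lemma end_from_not_one:
  assumes "\<not> one p j" "j < p" "j < m"
  shows "end_from p (Suc j) w = end_from p j w"
proof -
  consider "w = p" | "w = j" | "w \<noteq> p" "w \<noteq> j" by blast
  then show ?thesis
  proof cases
    case 1
    have "zigzag n T East p j = zigzag n T East p (Suc j)"
    proof (cases "(p, j) \<in> boxes n lam")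
      case True
      then show ?thesis using assms by (subst zigzag.simps(1)) (simp add: has_one_def)
    next
      case False
      then show ?thesis using no_box_right by (simp add: zigzag.simps(1))
    qed
    then show ?thesis using 1 assms by (simp add: end_from_def)
  next
    case 2
    have "zigzag n T South p j = zigzag n T South (Suc p) j"
    proof (cases "(p, j) \<in> boxes n lam")
      case True
      then show ?thesis using assms by (subst zigzag.simps(2)) (simp add: has_one_def)
    next
      case False
      then show ?thesis using no_box_below assms by (simp add: zigzag.simps(2))
    qed
    then show ?thesis using 2 assms by (simp add: end_from_def)
  next
    case 3
    then show ?thesis by (simp add: end_from_def less_Suc_eq)
  qed
qed

text \<open>
  At the end of an added row its wire turns south through the diagonal. With a 1 there the path turns
  by the zigzag rule; with a 0 it starts at the diagonal and goes straight on.
\<close>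

lemma end_from_next_row:
  assumes "p < n"
  shows "end_from (Suc p) 0 w = end_from p (min p m) w"
proof -
  consider "w < p" | "w = p" "p < m" | "w = p" "m \<le> p" | "w = Suc p" | "Suc p < w" by linarith
  then show ?thesis
  proof cases
    case 2
    have dg: "(p, p) \<in> boxes n lam" using 2 diagonal_box by simp
    show ?thesis
    proof (cases "fill T (p, p) = 0")
      case True
      then show ?thesis using 2 dg by (simp add: end_from_def wire_end_def zigzag.simps(2)[of n T p p])
    next
      case False
      then have "fill T (p, p) = 1" using fill_range[OF dg] by auto
      then show ?thesis using 2 dg by (simp add: end_from_def zigzag.simps(1)[of n T p p])
    qed
  next
    case 3
    then have "(p, m) \<notin> boxes n lam" by (simp add: boxes_def)
    then show ?thesis using 3 by (simp add: end_from_def lab_def zigzag.simps(1)[of n T p m])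
  qed (auto simp: end_from_def wire_end_def)
qed

definition swept :: "nat \<Rightarrow> nat \<Rightarrow> (nat \<times> nat) set" where
  "swept p j = {(q, i). one q i \<and> i < q \<and> (q < p \<or> q = p \<and> i < j)}"

text \<open>
  If there is a 1 to the left of \<open>(p, j)\<close>, condition (ii) forbids a 1 above it. This includes the
  diagonal \<open>(j, j)\<close>, so row \<open>j\<close> is empty by condition (iii), and wire \<open>j\<close> is untouched. Otherwise
  wire \<open>p\<close> is untouched, since its column part lies below row \<open>p\<close>.
\<close>

lemma new_wire:
  assumes "one p j" "j < p"
  shows "p \<notin> Field (swept p j) \<or> j \<notin> Field (swept p j)"
proof (cases "\<exists>j' < j. one p j'")
  case True
  then have above: "\<not> (p' < p \<and> one p' j)" for p' using topmost_or_leftmost[OF assms(1)] by blast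
  have "j < m" using one_bounds[OF assms(1)] by simp
  then have "\<not> one j i" for i using above[of j] one_diagonal assms by blast
  then show ?thesis using above by (auto simp: Field_def swept_def)
next
  case False
  then show ?thesis by (auto simp: Field_def swept_def)
qed

lemma swept_Suc:
  "swept p (Suc j) = (if one p j \<and> j < p then insert (p, j) (swept p j) else swept p j)"
  by (auto simp: swept_def less_Suc_eq)

lemma swept_next_row: "swept (Suc p) 0 = swept p (min p m)"
  using one_bounds by (auto simp: swept_def less_Suc_eq)

text \<open>
  The permutation \<open>\<pi>\<close> tells which wire each path is on at the current stage of the sweep. A 1 at
  \<open>(p, j)\<close> exchanges the wires \<open>p\<close> and \<open>j\<close>, that is, composes \<open>\<pi>\<close> on the left with a
  transposition.
\<close>

lemma sweep:
  assumes "p \<le> n"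
  shows "\<exists>\<pi>. grown {..<n} (swept p 0) \<pi> \<and> (\<forall>w. end_from p 0 (\<pi> w) = wire_end w)"
  using assms
proof (induction p)
  case 0
  have "swept 0 0 = {}" by (auto simp: swept_def)
  then show ?case using grown.empty end_from_0 by (metis id_apply)
next
  case (Suc p)
  have "\<exists>\<pi>. grown {..<n} (swept p j) \<pi> \<and> (\<forall>w. end_from p j (\<pi> w) = wire_end w)"
    if "j \<le> min p m" for j
    using that
  proof (induction j)
    case 0
    then show ?case using Suc by simp
  next
    case (Suc j)
    then obtain \<pi> where \<pi>: "grown {..<n} (swept p j) \<pi>" "\<forall>w. end_from p j (\<pi> w) = wire_end w"
      by auto
    have j: "j < p" "j < m" using Suc.prems by auto
    show ?case
    proof (cases "one p j")
      case True
      have "grown {..<n} (swept p (Suc j)) (transpose p j \<circ> \<pi>)"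
        using grown.attach[OF \<pi>(1) _ _ _ new_wire[OF True j(1)]] j True \<open>Suc p \<le> n\<close>
        by (simp add: swept_Suc)
      then show ?thesis using \<pi>(2) end_from_one[OF True j(1)] by (metis comp_apply)
    next
      case False
      then show ?thesis using \<pi> end_from_not_one[OF False j] by (auto simp: swept_Suc)
    qed
  qed
  from this[of "min p m"] show ?case
    using Suc.prems by (simp add: swept_next_row end_from_next_row)
qed

section \<open>Counting the ones\<close>

text \<open>
  Topmost 1's correspond to columns and leftmost 1's to nonzero rows; together they are all 1's, and
  their intersection is counted by \<open>dess\<close>. The nonzero added rows are those with a 1 in the diagonal,
  so the diagonal 1's cancel.
\<close>

lemma count_ones: "card (swept n 0) + dess n T + zerorow n T = n"
proof -
  define Ones where "Ones = {(p, j). one p j}"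
  define Top where "Top = {(p, j). one p j \<and> \<not> (\<exists>p' < p. one p' j)}"
  define Left where "Left = {(p, j). one p j \<and> \<not> (\<exists>j' < j. one p j')}"
  define Diag where "Diag = {(p, j). one p j \<and> p = j}"
  define Zero where "Zero = {p. m \<le> p \<and> p < n \<and> (\<forall>j. \<not> one p j)}"
  have "Ones \<subseteq> {..<n} \<times> {..<n}" using one_bounds by (fastforce simp: Ones_def)
  then have fin: "finite Ones" by (rule finite_subset) simp
  have sub: "Top \<subseteq> Ones" "Left \<subseteq> Ones" "Diag \<subseteq> Ones" "swept n 0 \<subseteq> Ones"
    by (auto simp: Ones_def Top_def Left_def Diag_def swept_def)
  note fins = sub[THEN finite_subset, OF fin]
  have "Ones = Top \<union> Left"
    using topmost_or_leftmost by (auto simp: Ones_def Top_def Left_def)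
  then have 1: "card Ones + card (Top \<inter> Left) = card Top + card Left"
    using card_Un_Int[OF fins(1,2)] by simp
  have 2: "card (Top \<inter> Left) = dess n T"
    unfolding dess_def by (rule arg_cong[of _ _ card]) (auto simp: Top_def Left_def)
  have "bij_betw snd Top {..<m}"
  proof (rule bij_betw_imageI)
    show "inj_on snd Top" by (rule inj_onI) (auto simp: Top_def, metis nat_neq_iff)
    show "snd ` Top = {..<m}"
    proof (intro equalityI subsetI)
      fix j assume "j \<in> {..<m}"
      then have ex: "\<exists>p. one p j" using column_has_one by simp
      then have "((LEAST p. one p j), j) \<in> Top"
        by (auto simp: Top_def intro: LeastI dest: not_less_Least)
      then show "j \<in> snd ` Top" by force
    qed (use one_bounds in \<open>auto simp: Top_def\<close>)
  qed
  then have 3: "card Top = m" using bij_betw_same_card by fastforce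
  have "bij_betw fst Left (fst ` Diag \<union> ({m..<n} - Zero))"
  proof (rule bij_betw_imageI)
    show "inj_on fst Left" by (rule inj_onI) (auto simp: Left_def, metis nat_neq_iff)
    show "fst ` Left = fst ` Diag \<union> ({m..<n} - Zero)"
    proof (intro equalityI subsetI)
      fix p assume "p \<in> fst ` Left"
      then obtain j where "one p j" by (auto simp: Left_def)
      then show "p \<in> fst ` Diag \<union> ({m..<n} - Zero)"
        using one_bounds[of p j] one_diagonal[of p j]
        by (cases "p < m") (force simp: Diag_def Zero_def)+
    next
      fix p assume "p \<in> fst ` Diag \<union> ({m..<n} - Zero)"
      then have ex: "\<exists>j. one p j" by (auto simp: Diag_def Zero_def)
      then have "(p, LEAST j. one p j) \<in> Left"
        by (auto simp: Left_def intro: LeastI dest: not_less_Least)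
      then show "p \<in> fst ` Left" by force
    qed
  qed
  then have "card Left = card (fst ` Diag \<union> ({m..<n} - Zero))" by (rule bij_betw_same_card)
  also have "\<dots> = card (fst ` Diag) + card ({m..<n} - Zero)"
    using fins by (intro card_Un_disjoint) (auto simp: Diag_def dest: one_bounds(2))
  also have "card (fst ` Diag) = card Diag"
    by (intro card_image inj_onI) (auto simp: Diag_def)
  also have "card ({m..<n} - Zero) = (n - m) - card Zero"
    by (subst card_Diff_subset) (auto simp: Zero_def)
  finally have 4: "card Left = card Diag + ((n - m) - card Zero)" .
  have 5: "card Zero \<le> n - m" using card_mono[of "{m..<n}" Zero] by (simp add: Zero_def subset_iff)
  have "Ones = swept n 0 \<union> Diag" "swept n 0 \<inter> Diag = {}"
    by (auto simp: Ones_def swept_def Diag_def le_less dest: one_bounds)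
  then have 6: "card Ones = card (swept n 0) + card Diag"
    using card_Un_disjoint fins by metis
  have 7: "card Zero = zerorow n T"
    unfolding zerorow_def Zero_def
    using fill_range row_label_pos_iff
    by (intro arg_cong[of _ _ card]) (fastforce simp: has_one_def)
  show ?thesis using 1 2 3 4 5 6 7 diff_le_self[of n "length lam"] by linarith
qed

theorem cyc_zeta_bare: "cyc n (zeta_bare n T) = dess n T + zerorow n T"
proof -
  obtain \<pi> where \<pi>: "grown {..<n} (swept n 0) \<pi>" "\<And>w. end_from n 0 (\<pi> w) = wire_end w"
    using sweep[of n] by auto
  obtain cs where cs: "cycle_lists {..<n} \<pi> cs" "length cs + card (swept n 0) = n"
    using grown_cycle_lists[OF \<pi>(1)] by auto
  have perm: "\<pi> permutes {..<n}" using \<pi>(1) by (rule grown_permutes)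
  have "cyc n (zeta_bare n T) = length cs"
  proof (rule cyc_relabelled[OF lab_bij perm cs(1)])
    fix w assume "w \<in> {..<n}"
    then have w: "w < n" "\<pi> w < n" using permutes_in_image[OF perm, of w] by auto
    then show "\<bar>zeta_bare n T (lab w)\<bar> = lab (\<pi> w)"
      using abs_zeta_bare_lab[OF w(1)] \<pi>(2)[of w] end_from_n[OF w(2)] lab_range[OF w(2)] by simp
  qed (auto simp: zeta_bare_def signed_range_def)
  then show ?thesis using cs(2) count_ones by simp
qed

end

theorem theorem5p1:
  fixes n :: nat and T :: tableau
  assumes "n \<ge> 1" and "T \<in> bare_tableaux_B n"
  shows "cyc n (zeta_bare n T) = dess n T + zerorow n T"
  using assms(2) bare_tableau.cyc_zeta_bare[OF bare_tableau.intro] by simp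

end
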